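(* Let $\mathcal{P}_1,\mathcal{P}_2$ be weakly ranked posets with kernels $\kappa_1,\kappa_2$, and let $\kappa=\kappa_1\otimes\kappa_2$ be the resulting kernel of the weakly ranked poset $\mathcal{P}_1\times\mathcal{P}_2$. Let $H_1,H_2,H$ be the Chow functions of $\mathcal{P}_1$, $\mathcal{P}_2$, $\mathcal{P}_1\times\mathcal{P}_2$ with respect to $\kappa_1,\kappa_2,\kappa$ respectively. Then, in the incidence algebra of $\mathcal{P}_1\times\mathcal{P}_2$, $$H=H_1\otimes H_2+xH\cdot(H_1\otimes H_2)-xH\cdot(I\otimes H_2)-xH\cdot(H_1\otimes I)+xH$$ and $$H=H_1\otimes H_2+x(H_1\otimes H_2)\cdot H-x(I\otimes H_2)\cdot H-x(H_1\otimes I)\cdot H+xH.$$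
   Context: A weakly ranked poset is a (locally finite) poset $\mathcal{P}$ with a function $\mathrm{rk}$ assigning to each pair $s\le t$ (interval $[s,t]$) an integer $\mathrm{rk}(s,t)$ such that $\mathrm{rk}(s,t)>0$ if $s<t$, and $\mathrm{rk}(s,t)=\mathrm{rk}(s,u)+\mathrm{rk}(u,t)$ if $s\le u\le t$. The incidence algebra $\mathcal{J}(\mathcal{P})$ consists of the functions $a$ assigning to each $s\le t$ a polynomial $a_{s,t}\in\mathbb{Z}[x]$ (equivalently, $\mathcal{P}\times\mathcal{P}$ matrices over $\mathbb{Z}[x]$ supported on pairs $s\le t$), with product $(a\cdot b)_{s,t}=\sum_{s\le u\le t}a_{s,u}b_{u,t}$; $I$ denotes the identity element. $\mathcal{J}_{\mathrm{rk}}(\mathcal{P})$ is the subalgebra of $a$ with $\deg a_{s,t}\le\mathrm{rk}(s,t)$. For $a\in\mathcal{J}_{\mathrm{rk}}(\mathcal{P})$, $(a^{\mathrm{rev}})_{s,t}=x^{\mathrm{rk}(s,t)}a_{s,t}(x^{-1})$. A kernel is an element $\kappa\in\mathcal{J}_{\mathrm{rk}}(\mathcal{P})$ with $\kappa_{s,s}=1$ for all $s$ and $\kappa^{-1}=\kappa^{\mathrm{rev}}$; then $x-1$ divides $\kappa_{s,t}$ for $s<t$. The reduced kernel $\overline\kappa$ is given by $\overline\kappa_{s,t}=\kappa_{s,t}/(x-1)$ for $s<t$ and $\overline\kappa_{s,s}=-1$. The Chow function of $(\mathcal{P},\kappa)$ is $H=-(\overline\kappa)^{-1}$. $\mathcal{P}_1\times\mathcal{P}_2$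 has the componentwise order and weak rank function $\mathrm{rk}((s_1,s_2),(t_1,t_2))=\mathrm{rk}_1(s_1,t_1)+\mathrm{rk}_2(s_2,t_2)$. For $a_i\in\mathcal{J}(\mathcal{P}_i)$, $a_1\otimes a_2\in\mathcal{J}(\mathcal{P}_1\times\mathcal{P}_2)$ is $(a_1\otimes a_2)_{(s_1,s_2),(t_1,t_2)}=(a_1)_{s_1,t_1}(a_2)_{s_2,t_2}$. In $I\otimes H_2$ (resp. $H_1\otimes I$), $I$ is the identity of $\mathcal{J}(\mathcal{P}_1)$ (resp. $\mathcal{J}(\mathcal{P}_2)$). *)

theory Defs
  imports "HOL-Computational_Algebra.Polynomial" "HOL-Library.Product_Order"
begin

class locally_finite_order = order +
  assumes finite_interval: "finite {s..t}"

instance prod :: (locally_finite_order, locally_finite_order) locally_finite_order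
proof
  fix s t :: "'a \<times> 'b"
  have "{s..t} = {fst s..fst t} \<times> {snd s..snd t}"
    by (auto simp: less_eq_prod_def)
  then show "finite {s..t}" by (simp add: finite_interval)
qed

text \<open>Only the values of a weak rank function on comparable pairs matter.\<close>

definition weak_rank :: "('a::order \<Rightarrow> 'a \<Rightarrow> int) \<Rightarrow> bool" where
  "weak_rank rk \<longleftrightarrow>
     (\<forall>s t. s < t \<longrightarrow> rk s t > 0) \<and>
     (\<forall>s u t. s \<le> u \<and> u \<le> t \<longrightarrow> rk s t = rk s u + rk u t)"

definition prod_rank ::
  "('a \<Rightarrow> 'a \<Rightarrow> int) \<Rightarrow> ('b \<Rightarrow> 'b \<Rightarrow> int) \<Rightarrow> 'a \<times> 'b \<Rightarrow> 'a \<times> 'b \<Rightarrow> int" where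
  "prod_rank rk1 rk2 p q = rk1 (fst p) (fst q) + rk2 (snd p) (snd q)"

typedef (overloaded) 'a incidence =
  "{f :: 'a::order \<Rightarrow> 'a \<Rightarrow> int poly. \<forall>s t. \<not> s \<le> t \<longrightarrow> f s t = 0}"
  morphisms entry Abs_incidence
  by (rule exI[of _ "\<lambda>_ _. 0"]) simp

setup_lifting type_definition_incidence

lemma incidence_eqI: "(\<And>s t. s \<le> t \<Longrightarrow> entry a s t = entry b s t) \<Longrightarrow> a = b"
  by transfer (intro ext, metis)

lemma entry_not_le: "\<not> s \<le> t \<Longrightarrow> entry a s t = 0"
  by transfer simp

instantiation incidence :: (order) ab_group_add
begin

lift_definition zero_incidence :: "'a incidence" is "\<lambda>_ _. 0" by simp

lift_definition plus_incidence :: "'a incidence \<Rightarrow> 'a incidence \<Rightarrow> 'a incidence"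
  is "\<lambda>a b s t. a s t + b s t" by simp

lift_definition uminus_incidence :: "'a incidence \<Rightarrow> 'a incidence"
  is "\<lambda>a s t. - a s t" by simp

lift_definition minus_incidence :: "'a incidence \<Rightarrow> 'a incidence \<Rightarrow> 'a incidence"
  is "\<lambda>a b s t. a s t - b s t" by simp

instance by standard (transfer; simp add: fun_eq_iff)+

end

instantiation incidence :: (locally_finite_order) ring
begin

lift_definition times_incidence :: "'a incidence \<Rightarrow> 'a incidence \<Rightarrow> 'a incidence"
  is "\<lambda>a b s t. \<Sum>u\<in>{s..t}. a s u * b u t" by simp

instance
proof
  fix a b c :: "'a incidence"
  show "(a + b) * c = a * c + b * c"
    by transfer (simp add: fun_eq_iff algebra_simps sum.distrib)
  show "a * (b + c) = a * b + a * c"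
    by transfer (simp add: fun_eq_iff algebra_simps sum.distrib)
  show "a * b * c = a * (b * c)"
  proof (rule incidence_eqI)
    fix s t :: 'a
    have "entry (a * b * c) s t =
        (\<Sum>u\<in>{s..t}. \<Sum>v\<in>{s..u}. entry a s v * entry b v u * entry c u t)"
      by (simp add: times_incidence.rep_eq sum_distrib_right)
    also have "\<dots> = (\<Sum>(u, v)\<in>(SIGMA u:{s..t}. {s..u}). entry a s v * entry b v u * entry c u t)"
      by (subst sum.Sigma) (auto simp: finite_interval)
    also have "\<dots> = (\<Sum>(v, u)\<in>(SIGMA v:{s..t}. {v..t}). entry a s v * entry b v u * entry c u t)"
      by (rule sum.reindex_bij_witness[of _ prod.swap prod.swap]) (auto intro: order_trans)
    also have "\<dots> = (\<Sum>v\<in>{s..t}. \<Sum>u\<in>{v..t}. entry a s v * entry b v u * entry c u t)"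
      by (subst sum.Sigma) (auto simp: finite_interval)
    also have "\<dots> = entry (a * (b * c)) s t"
      by (simp add: times_incidence.rep_eq sum_distrib_left mult.assoc)
    finally show "entry (a * b * c) s t = entry (a * (b * c)) s t" .
  qed
qed

end

instantiation incidence :: (locally_finite_order) ring_1
begin

lift_definition one_incidence :: "'a incidence" is "\<lambda>s t. if s = t then 1 else 0" by simp

instance
proof
  fix a :: "'a incidence"
  have l: "entry (1 * a) s t = entry a s t" if "s \<le> t" for s t
  proof -
    have "entry (1 * a) s t = (\<Sum>u\<in>{s..t}. if u = s then entry a u t else 0)"
      unfolding times_incidence.rep_eq one_incidence.rep_eq by (rule sum.cong) auto
    then show ?thesis using that by (simp add: sum.delta finite_interval)
  qed
  have r: "entry (a * 1) s t = entry a s t" if "s \<le> t" for s t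
  proof -
    have "entry (a * 1) s t = (\<Sum>u\<in>{s..t}. if u = t then entry a s u else 0)"
      unfolding times_incidence.rep_eq one_incidence.rep_eq by (rule sum.cong) auto
    then show ?thesis using that by (simp add: sum.delta finite_interval)
  qed
  show "1 * a = a" by (rule incidence_eqI) (rule l)
  show "a * 1 = a" by (rule incidence_eqI) (rule r)
  show "(0::'a incidence) \<noteq> 1"
    by transfer (metis (full_types) zero_neq_one)
qed

end

definition scale :: "int poly \<Rightarrow> 'a::order incidence \<Rightarrow> 'a incidence" (infixr "*\<^sub>p" 75) where
  "p *\<^sub>p a = Abs_incidence (\<lambda>s t. p * entry a s t)"

lemma entry_scale: "entry (p *\<^sub>p a) s t = p * entry a s t"
  unfolding scale_def by (subst Abs_incidence_inverse) (auto simp: entry_not_le)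

abbreviation polyX :: "int poly" where "polyX \<equiv> [:0, 1:]"

text \<open>\<open>b\<close> is the two-sided inverse of \<open>a\<close>; it is unique if it exists.
  \<open>incidence_inv\<close> is meaningful for invertible elements only.\<close>

definition is_inverse :: "'a::locally_finite_order incidence \<Rightarrow> 'a incidence \<Rightarrow> bool" where
  "is_inverse a b \<longleftrightarrow> a * b = 1 \<and> b * a = 1"

definition incidence_inv :: "'a::locally_finite_order incidence \<Rightarrow> 'a incidence" where
  "incidence_inv a = (THE b. is_inverse a b)"

lemma incidence_inv_eq:
  assumes "is_inverse a b" shows "incidence_inv a = b"
  unfolding incidence_inv_def
proof (rule the_equality[where P = "is_inverse a", OF assms])
  fix c assume "is_inverse a c"
  then have "c = c * (a * b)" "c * a = 1" using assms by (auto simp: is_inverse_def)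
  then show "c = b" by (metis mult.assoc mult_1_left)
qed

definition rank_bounded :: "('a::order \<Rightarrow> 'a \<Rightarrow> int) \<Rightarrow> 'a incidence set" where
  "rank_bounded rk = {a. \<forall>s t. s \<le> t \<longrightarrow> int (degree (entry a s t)) \<le> rk s t}"

text \<open>For \<open>degree p \<le> n\<close> this is \<open>x ^ n * p (1 / x)\<close>, expanded into monomials;
  see \<open>poly_rev_poly\<close> below.\<close>

definition rev_poly :: "nat \<Rightarrow> 'c::comm_ring_1 poly \<Rightarrow> 'c poly" where
  "rev_poly n p = (\<Sum>i\<le>n. monom (coeff p i) (n - i))"

lemma poly_rev_poly:
  fixes p :: "'c::field poly"
  assumes "degree p \<le> n" "x \<noteq> 0"
  shows "poly (rev_poly n p) x = x ^ n * poly p (1 / x)"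
proof -
  have "poly p (1 / x) = (\<Sum>i\<le>n. coeff p i * (1 / x) ^ i)"
    by (subst arg_cong[OF poly_as_sum_of_monoms'[OF assms(1), symmetric], of "\<lambda>q. poly q (1 / x)"])
       (simp add: poly_sum poly_monom)
  moreover have "x ^ (n - i) = x ^ n * (1 / x) ^ i" if "i \<le> n" for i
    using that assms(2) by (simp add: power_diff power_one_over)
  ultimately show ?thesis
    by (simp add: rev_poly_def poly_sum poly_monom sum_distrib_left mult.left_commute)
qed

lemma poly_rev_poly_1:
  assumes "degree p \<le> n"
  shows "poly (rev_poly n p) 1 = poly p 1"
proof -
  have "poly p 1 = (\<Sum>i\<le>n. coeff p i)"
    by (subst arg_cong[OF poly_as_sum_of_monoms'[OF assms, symmetric], of "\<lambda>q. poly q 1"])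
       (simp add: poly_sum poly_monom)
  then show ?thesis by (simp add: rev_poly_def poly_sum poly_monom)
qed

lemma rev_poly_sum: "rev_poly n (sum f A) = (\<Sum>x\<in>A. rev_poly n (f x))"
  unfolding rev_poly_def coeff_sum
  by (subst sum.swap) (simp add: monom_sum)

lemma rev_poly_monom: "i \<le> n \<Longrightarrow> rev_poly n (monom c i) = monom c (n - i)"
proof -
  assume "i \<le> n"
  have "rev_poly n (monom c i) = (\<Sum>j\<le>n. if j = i then monom c (n - j) else 0)"
    unfolding rev_poly_def by (rule sum.cong) auto
  with \<open>i \<le> n\<close> show ?thesis by (simp add: sum.delta)
qed

lemma rev_poly_mult:
  assumes "degree p \<le> m" "degree q \<le> n"
  shows "rev_poly (m + n) (p * q) = rev_poly m p * rev_poly n q"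
proof -
  have "p * q = (\<Sum>i\<le>m. monom (coeff p i) i) * (\<Sum>j\<le>n. monom (coeff q j) j)"
    using assms by (simp add: poly_as_sum_of_monoms')
  also have "\<dots> = (\<Sum>i\<le>m. \<Sum>j\<le>n. monom (coeff p i * coeff q j) (i + j))"
    by (simp add: sum_product mult_monom)
  finally have "rev_poly (m + n) (p * q) =
      (\<Sum>i\<le>m. \<Sum>j\<le>n. rev_poly (m + n) (monom (coeff p i * coeff q j) (i + j)))"
    by (simp add: rev_poly_sum)
  also have "\<dots> = (\<Sum>i\<le>m. \<Sum>j\<le>n. monom (coeff p i * coeff q j) ((m - i) + (n - j)))"
    by (intro sum.cong refl) (simp add: rev_poly_monom)
  also have "\<dots> = rev_poly m p * rev_poly n q"
    by (simp add: rev_poly_def sum_product mult_monom)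
  finally show ?thesis .
qed

lift_definition rev_incidence :: "('a::order \<Rightarrow> 'a \<Rightarrow> int) \<Rightarrow> 'a incidence \<Rightarrow> 'a incidence"
  is "\<lambda>rk a s t. rev_poly (nat (rk s t)) (a s t)"
  by (simp add: rev_poly_def)

definition is_kernel :: "('a::locally_finite_order \<Rightarrow> 'a \<Rightarrow> int) \<Rightarrow> 'a incidence \<Rightarrow> bool" where
  "is_kernel rk \<kappa> \<longleftrightarrow>
     \<kappa> \<in> rank_bounded rk \<and> (\<forall>s. entry \<kappa> s s = 1) \<and> is_inverse \<kappa> (rev_incidence rk \<kappa>)"

lemma kernel_dvd:
  assumes rk: "weak_rank rk" and k: "is_kernel rk \<kappa>" and "s < t"
  shows "[:-1, 1:] dvd entry \<kappa> s t"
proof -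
  define M where "M s t = poly (entry \<kappa> s t) 1" for s t
  have deg: "degree (entry \<kappa> s t) \<le> nat (rk s t)" if "s \<le> t" for s t
    using k that by (auto simp: is_kernel_def rank_bounded_def dest!: spec)
  have M1: "M s s = 1" for s using k by (simp add: is_kernel_def M_def)
  have rev: "poly (entry (rev_incidence rk \<kappa>) s t) 1 = M s t" if "s \<le> t" for s t
    using that by (simp add: rev_incidence.rep_eq M_def deg poly_rev_poly_1)
  have conv: "(\<Sum>u\<in>{s..t}. M s u * M u t) = 0" if "s < t" for s t
  proof -
    have "\<kappa> * rev_incidence rk \<kappa> = 1" using k by (simp add: is_kernel_def is_inverse_def)
    then have "poly (entry (\<kappa> * rev_incidence rk \<kappa>) s t) 1 = 0"
      using that by (simp add: one_incidence.rep_eq)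
    then show ?thesis
      by (simp add: times_incidence.rep_eq poly_sum rev M_def[symmetric])
  qed
  have "M s t = 0" if "s < t" for s t
    using that
  proof (induction "card {s..t}" arbitrary: t rule: less_induct)
    case less
    have "(\<Sum>u\<in>{s..t}. M s u * M u t) = (\<Sum>u\<in>{s, t}. M s u * M u t)"
    proof (rule sum.mono_neutral_right)
      show "\<forall>u\<in>{s..t} - {s, t}. M s u * M u t = 0"
      proof
        fix u assume u: "u \<in> {s..t} - {s, t}"
        then have "{s..u} \<subset> {s..t}" by (auto intro: order_trans)
        then have "card {s..u} < card {s..t}" by (rule psubset_card_mono[OF finite_interval])
        with less(1)[of u] u show "M s u * M u t = 0" by (auto simp: less_le)
      qed
    qed (use less in \<open>auto simp: finite_interval\<close>)
    then show ?case using conv[OF less(2)] less(2) by (simp add: M1)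
  qed
  then have "poly (entry \<kappa> s t) 1 = 0" using \<open>s < t\<close> by (simp add: M_def)
  then show ?thesis by (simp add: poly_eq_0_iff_dvd)
qed

text \<open>The division is exact for kernels, by \<open>kernel_dvd\<close> below.\<close>

lift_definition reduced_kernel :: "'a::order incidence \<Rightarrow> 'a incidence"
  is "\<lambda>\<kappa> s t. if s < t then \<kappa> s t div [:-1, 1:] else if s = t then -1 else 0"
  by (auto simp: less_le)

definition chow_function :: "'a::locally_finite_order incidence \<Rightarrow> 'a incidence" where
  "chow_function \<kappa> = - incidence_inv (reduced_kernel \<kappa>)"

lift_definition tensor ::
    "'a::order incidence \<Rightarrow> 'b::order incidence \<Rightarrow> ('a \<times> 'b) incidence" (infixr "\<otimes>" 80)
  is "\<lambda>a b p q. a (fst p) (fst q) * b (snd p) (snd q)"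
  by (auto simp: less_eq_prod_def)

lemma tensor_mult:
  fixes a1 b1 :: "'a::locally_finite_order incidence" and a2 b2 :: "'b::locally_finite_order incidence"
  shows "(a1 \<otimes> a2) * (b1 \<otimes> b2) = (a1 * b1) \<otimes> (a2 * b2)"
proof (rule incidence_eqI)
  fix p q :: "'a \<times> 'b"
  have "{p..q} = {fst p..fst q} \<times> {snd p..snd q}"
    by (auto simp: less_eq_prod_def)
  then show "entry ((a1 \<otimes> a2) * (b1 \<otimes> b2)) p q = entry ((a1 * b1) \<otimes> (a2 * b2)) p q"
    by (simp add: times_incidence.rep_eq tensor.rep_eq sum_product sum.cartesian_product
        case_prod_beta mult_ac)
qed

lemma tensor_one: "(1 :: 'a::locally_finite_order incidence) \<otimes> (1 :: 'b::locally_finite_order incidence) = 1"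
  by (rule incidence_eqI) (auto simp: tensor.rep_eq one_incidence.rep_eq prod_eq_iff)

lemma weak_rank_nonneg: "weak_rank rk \<Longrightarrow> s \<le> t \<Longrightarrow> 0 \<le> rk s t"
  unfolding weak_rank_def
  by (metis add_cancel_left_left order_le_less order_refl)

lemma weak_rank_prod:
  assumes "weak_rank rk1" "weak_rank rk2"
  shows "weak_rank (prod_rank rk1 rk2)"
  unfolding weak_rank_def
proof (intro conjI allI impI)
  fix p q :: "'a \<times> 'b"
  assume "p < q"
  then have "fst p < fst q \<and> snd p \<le> snd q \<or> fst p \<le> fst q \<and> snd p < snd q"
    by (auto simp: less_prod_def less_eq_prod_def less_le prod_eq_iff)
  then show "prod_rank rk1 rk2 p q > 0"
    using assms weak_rank_nonneg[OF assms(1)] weak_rank_nonneg[OF assms(2)]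
    unfolding prod_rank_def weak_rank_def by (meson add_nonneg_pos add_pos_nonneg)
next
  fix p r q :: "'a \<times> 'b"
  assume "p \<le> r \<and> r \<le> q"
  then have "rk1 (fst p) (fst q) = rk1 (fst p) (fst r) + rk1 (fst r) (fst q)"
    and "rk2 (snd p) (snd q) = rk2 (snd p) (snd r) + rk2 (snd r) (snd q)"
    using assms unfolding weak_rank_def less_eq_prod_def by blast+
  then show "prod_rank rk1 rk2 p q = prod_rank rk1 rk2 p r + prod_rank rk1 rk2 r q"
    by (simp add: prod_rank_def)
qed

lemma is_kernel_tensor:
  assumes "weak_rank rk1" "weak_rank rk2" "is_kernel rk1 \<kappa>1" "is_kernel rk2 \<kappa>2"
  shows "is_kernel (prod_rank rk1 rk2) (\<kappa>1 \<otimes> \<kappa>2)"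
proof -
  have d1: "int (degree (entry \<kappa>1 s t)) \<le> rk1 s t" if "s \<le> t" for s t
    using assms(3) that by (auto simp: is_kernel_def rank_bounded_def)
  have d2: "int (degree (entry \<kappa>2 s t)) \<le> rk2 s t" if "s \<le> t" for s t
    using assms(4) that by (auto simp: is_kernel_def rank_bounded_def)
  have "\<kappa>1 \<otimes> \<kappa>2 \<in> rank_bounded (prod_rank rk1 rk2)"
  proof (unfold rank_bounded_def, intro CollectI allI impI)
    fix p q :: "'a \<times> 'b" assume "p \<le> q"
    then show "int (degree (entry (\<kappa>1 \<otimes> \<kappa>2) p q)) \<le> prod_rank rk1 rk2 p q"
      using d1[of "fst p" "fst q"] d2[of "snd p" "snd q"]
        degree_mult_le[of "entry \<kappa>1 (fst p) (fst q)" "entry \<kappa>2 (snd p) (snd q)"]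
      by (simp add: tensor.rep_eq prod_rank_def less_eq_prod_def)
  qed
  moreover have "rev_incidence (prod_rank rk1 rk2) (\<kappa>1 \<otimes> \<kappa>2) =
      rev_incidence rk1 \<kappa>1 \<otimes> rev_incidence rk2 \<kappa>2"
  proof (rule incidence_eqI)
    fix p q :: "'a \<times> 'b" assume "p \<le> q"
    then have le: "fst p \<le> fst q" "snd p \<le> snd q" by (auto simp: less_eq_prod_def)
    have "nat (prod_rank rk1 rk2 p q) = nat (rk1 (fst p) (fst q)) + nat (rk2 (snd p) (snd q))"
      using le weak_rank_nonneg[OF assms(1)] weak_rank_nonneg[OF assms(2)]
      by (simp add: prod_rank_def nat_add_distrib)
    then show "entry (rev_incidence (prod_rank rk1 rk2) (\<kappa>1 \<otimes> \<kappa>2)) p q =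
        entry (rev_incidence rk1 \<kappa>1 \<otimes> rev_incidence rk2 \<kappa>2) p q"
      using d1[OF le(1)] d2[OF le(2)]
      by (simp add: rev_incidence.rep_eq tensor.rep_eq rev_poly_mult)
  qed
  ultimately show ?thesis
    using assms(3,4) by (simp add: is_kernel_def is_inverse_def tensor_mult tensor_one tensor.rep_eq)
qed

end

theory Submission
  imports Defs
begin

text \<open>
  Write \<open>x\<close> for the variable and \<open>r \<kappa>\<close> for the reduced kernel. The value \<open>-1\<close> on the
  diagonal of \<open>r \<kappa>\<close> is exactly what makes \<open>(x - 1) r \<kappa> = \<kappa> - x I\<close> hold on all intervals
  (lemma \<open>scale_reduced_kernel\<close>). Substituting \<open>\<kappa>\<^sub>i = (x - 1) r \<kappa>\<^sub>i + x I\<close> into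
  \<open>\<kappa>\<^sub>1 \<otimes> \<kappa>\<^sub>2 - x I\<close>, expanding and cancelling one factor \<open>x - 1\<close> gives (lemma
  \<open>reduced_kernel_tensor\<close>)

  \<open>r (\<kappa>\<^sub>1 \<otimes> \<kappa>\<^sub>2) = (x - 1) (r \<kappa>\<^sub>1 \<otimes> r \<kappa>\<^sub>2) + x (r \<kappa>\<^sub>1 \<otimes> I) + x (I \<otimes> r \<kappa>\<^sub>2) + x I\<close>.

  Since \<open>r \<kappa>\<^sub>i\<close> and \<open>H\<^sub>i\<close> multiply to \<open>-I\<close> in either order, multiplying this equation by
  \<open>H\<^sub>1 \<otimes> H\<^sub>2\<close> on the right and then by \<open>H\<close> on the left turns it into the first recursion, and
  multiplying on the opposite sides gives the second.

  For these products to be available, the Chow functions must be genuine two-sided inverses: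
  \<open>- r \<kappa>\<close> is unitriangular, and unitriangular elements of an incidence algebra are
  invertible (lemma \<open>unitriangular_invertible\<close>).
\<close>

section \<open>Inverses of unitriangular elements\<close>

text \<open>
  The equation \<open>a * b = 1\<close> with \<open>a\<close> unitriangular, solved for the entry of \<open>b\<close> on \<open>[s, t]\<close>.
  Off the order relation the index set is empty, so the value is \<open>0\<close> there.
\<close>

function right_inverse_entry :: "'a::locally_finite_order incidence \<Rightarrow> 'a \<Rightarrow> 'a \<Rightarrow> int poly" where
  "right_inverse_entry a s t =
     (if s = t then 1 else - (\<Sum>u\<in>{s<..t}. entry a s u * right_inverse_entry a u t))"
  by auto
termination
proof (relation "Wellfounded.measure (\<lambda>(a, s, t). card {s..t})", goal_cases)
  case (2 a s t u)
  then have "s \<notin> {u..t}" "s \<in> {s..t}" "{u..t} \<subseteq> {s..t}"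
    by (auto simp: less_le_not_le intro: order_trans)
  then have "{u..t} \<subset> {s..t}" by blast
  then show ?case by (simp add: psubset_card_mono finite_interval)
qed simp

declare right_inverse_entry.simps [simp del]

lemma unitriangular_right_inverse:
  fixes a :: "'a::locally_finite_order incidence"
  assumes diag: "\<And>s. entry a s s = 1"
  obtains b where "a * b = 1" and "\<And>s. entry b s s = 1"
proof
  let ?b = "Abs_incidence (right_inverse_entry a)"
  have supp: "right_inverse_entry a s t = 0" if "\<not> s \<le> t" for s t
  proof -
    from that have empty: "{s<..t} = {}" and "s \<noteq> t" by auto
    then show ?thesis by (subst right_inverse_entry.simps) (simp only: empty if_False sum.empty minus_zero)
  qed
  have b: "entry ?b = right_inverse_entry a"
    by (rule Abs_incidence_inverse) (simp add: supp)
  show "entry ?b s s = 1" for s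
    by (simp add: b right_inverse_entry.simps[of a s s])
  show "a * ?b = 1"
  proof (rule incidence_eqI)
    fix s t :: 'a
    assume "s \<le> t"
    then have "{s..t} = insert s {s<..t}" by (auto simp: less_le)
    moreover have "finite {s<..t}"
      by (rule finite_subset[OF _ finite_interval[of s t]]) auto
    ultimately have "entry (a * ?b) s t =
        right_inverse_entry a s t + (\<Sum>u\<in>{s<..t}. entry a s u * right_inverse_entry a u t)"
      by (simp add: times_incidence.rep_eq b diag)
    also have "\<dots> = entry 1 s t"
      by (subst right_inverse_entry.simps[of a s t]) (simp add: one_incidence.rep_eq)
    finally show "entry (a * ?b) s t = entry 1 s t" .
  qed
qed

text \<open>
  A right inverse of a unitriangular element is again unitriangular, so it has a right inverse
  in turn; in a monoid this makes both inverses two-sided.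
\<close>

lemma unitriangular_invertible:
  fixes a :: "'a::locally_finite_order incidence"
  assumes "\<And>s. entry a s s = 1"
  obtains b where "is_inverse a b"
proof -
  obtain b where ab: "a * b = 1" and "\<And>s. entry b s s = 1"
    using unitriangular_right_inverse[OF assms] by blast
  then obtain c where bc: "b * c = 1"
    using unitriangular_right_inverse by blast
  have "a = a * (b * c)" by (simp add: bc)
  also have "\<dots> = c" by (simp add: ab mult.assoc[symmetric])
  finally show thesis using ab bc that by (simp add: is_inverse_def)
qed

lemma is_inverse_minus:
  "is_inverse (- a) (- b) \<longleftrightarrow> is_inverse a b"
  by (simp add: is_inverse_def)

lemma is_inverse_chow_function:
  "is_inverse (- reduced_kernel \<kappa>) (chow_function \<kappa>)"
proof -
  have "entry (- reduced_kernel \<kappa>) s s = 1" for s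
    by (simp add: uminus_incidence.rep_eq reduced_kernel.rep_eq)
  then obtain b where b: "is_inverse (- reduced_kernel \<kappa>) b"
    using unitriangular_invertible by blast
  then have "incidence_inv (reduced_kernel \<kappa>) = - b"
    using is_inverse_minus[of "reduced_kernel \<kappa>" "- b"] by (simp add: incidence_inv_eq)
  with b show ?thesis by (simp add: chow_function_def)
qed

corollary reduced_kernel_mult_chow_function:
  "reduced_kernel \<kappa> * chow_function \<kappa> = - 1"
  "chow_function \<kappa> * reduced_kernel \<kappa> = - 1"
proof -
  have "- (reduced_kernel \<kappa> * chow_function \<kappa>) = 1"
    and "- (chow_function \<kappa> * reduced_kernel \<kappa>) = 1"
    using is_inverse_chow_function[of \<kappa>] by (simp_all add: is_inverse_def)
  then show "reduced_kernel \<kappa> * chow_function \<kappa> = - 1"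
    and "chow_function \<kappa> * reduced_kernel \<kappa> = - 1"
    by (metis minus_minus)+
qed

section \<open>Polynomial scalars and tensor products\<close>

lemmas entry_simps =
  entry_scale plus_incidence.rep_eq minus_incidence.rep_eq uminus_incidence.rep_eq
  tensor.rep_eq

lemma scale_mult_left: "(p *\<^sub>p a) * b = p *\<^sub>p (a * b)"
  by (rule incidence_eqI)
    (simp add: times_incidence.rep_eq entry_scale sum_distrib_left mult.assoc)

lemma scale_mult_right: "a * (p *\<^sub>p b) = p *\<^sub>p (a * b)"
  by (rule incidence_eqI)
    (simp add: times_incidence.rep_eq entry_scale sum_distrib_left mult.left_commute)

lemma scale_minus_right: "p *\<^sub>p (- a) = - (p *\<^sub>p a)"
  by (rule incidence_eqI) (simp add: entry_simps)

lemma scale_polyX_minus_one: "[:-1, 1:] *\<^sub>p a = polyX *\<^sub>p a - a"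
proof (rule incidence_eqI)
  fix s t
  have "[:-1, 1:] = polyX - (1 :: int poly)" by (simp add: one_pCons)
  then show "entry ([:-1, 1:] *\<^sub>p a) s t = entry (polyX *\<^sub>p a - a) s t"
    by (simp only: entry_simps left_diff_distrib mult_1_left)
qed

lemma scale_left_cancel:
  assumes "p \<noteq> 0" "p *\<^sub>p a = p *\<^sub>p b"
  shows "a = b"
proof (rule incidence_eqI)
  fix s t
  from assms(2) have "p * entry a s t = p * entry b s t"
    by (simp flip: entry_scale)
  with assms(1) show "entry a s t = entry b s t" by simp
qed

lemma tensor_minus_left: "(- a) \<otimes> b = - (a \<otimes> b)"
  by (rule incidence_eqI) (simp add: entry_simps)

lemma tensor_minus_right: "a \<otimes> (- b) = - (a \<otimes> b)"
  by (rule incidence_eqI) (simp add: entry_simps)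

section \<open>The reduced kernel of a product\<close>

lemma scale_reduced_kernel:
  assumes "weak_rank rk" "is_kernel rk \<kappa>"
  shows "[:-1, 1:] *\<^sub>p reduced_kernel \<kappa> = \<kappa> - polyX *\<^sub>p 1"
proof (rule incidence_eqI)
  fix s t :: 'a
  assume "s \<le> t"
  show "entry ([:-1, 1:] *\<^sub>p reduced_kernel \<kappa>) s t = entry (\<kappa> - polyX *\<^sub>p 1) s t"
  proof (cases "s = t")
    case True
    then show ?thesis
      using assms(2)
      by (simp add: entry_simps reduced_kernel.rep_eq one_incidence.rep_eq is_kernel_def one_pCons)
  next
    case False
    with \<open>s \<le> t\<close> have "s < t" by simp
    from kernel_dvd[OF assms this] show ?thesis
      using \<open>s < t\<close> False
      by (simp only: entry_simps reduced_kernel.rep_eq one_incidence.rep_eq if_True if_False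
          dvd_mult_div_cancel mult_zero_right diff_zero)
  qed
qed

lemma reduced_kernel_tensor:
  assumes "weak_rank rk1" "weak_rank rk2" "is_kernel rk1 \<kappa>1" "is_kernel rk2 \<kappa>2"
  defines "r1 \<equiv> reduced_kernel \<kappa>1" and "r2 \<equiv> reduced_kernel \<kappa>2"
  shows "reduced_kernel (\<kappa>1 \<otimes> \<kappa>2) =
    [:-1, 1:] *\<^sub>p (r1 \<otimes> r2) + polyX *\<^sub>p (r1 \<otimes> 1) + polyX *\<^sub>p (1 \<otimes> r2) + polyX *\<^sub>p 1"
    (is "_ = ?r")
proof (rule scale_left_cancel)
  have \<kappa>1: "\<kappa>1 = [:-1, 1:] *\<^sub>p r1 + polyX *\<^sub>p 1"
    unfolding r1_def scale_reduced_kernel[OF assms(1,3)] by simp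
  have \<kappa>2: "\<kappa>2 = [:-1, 1:] *\<^sub>p r2 + polyX *\<^sub>p 1"
    unfolding r2_def scale_reduced_kernel[OF assms(2,4)] by simp
  have "[:-1, 1:] *\<^sub>p reduced_kernel (\<kappa>1 \<otimes> \<kappa>2) = \<kappa>1 \<otimes> \<kappa>2 - polyX *\<^sub>p 1"
    using scale_reduced_kernel[OF weak_rank_prod is_kernel_tensor] assms(1-4) by blast
  also have "\<dots> = [:-1, 1:] *\<^sub>p ?r"
  proof (rule incidence_eqI)
    fix p q :: "'a \<times> 'b"
    \<comment> \<open>The polynomial identity behind the expansion; \<open>x\<^sup>2 e - x e = (x - 1) x e\<close> accounts for
      the identity element \<open>e = d * d'\<close>.\<close>
    have expand: "(y * a + x * d) * (y * b + x * d') - x * (d * d') =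
        y * (y * (a * b) + x * (a * d') + x * (d * b) + x * (d * d'))"
      if "y = x - 1" for a b d d' x y :: "int poly"
      unfolding that by (simp add: algebra_simps)
    have one: "(1 :: ('a \<times> 'b) incidence) = 1 \<otimes> 1" by (simp add: tensor_one)
    show "entry (\<kappa>1 \<otimes> \<kappa>2 - polyX *\<^sub>p 1) p q = entry ([:-1, 1:] *\<^sub>p ?r) p q"
      unfolding one \<kappa>1 \<kappa>2 entry_simps by (rule expand) (simp add: one_pCons)
  qed
  finally show "[:-1, 1:] *\<^sub>p reduced_kernel (\<kappa>1 \<otimes> \<kappa>2) = [:-1, 1:] *\<^sub>p ?r" .
qed simp

section \<open>The recursions for the Chow function of a product\<close>

theorem theorem1p9:
  fixes rk1 :: "'a::locally_finite_order \<Rightarrow> 'a \<Rightarrow> int"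
    and rk2 :: "'b::locally_finite_order \<Rightarrow> 'b \<Rightarrow> int"
    and \<kappa>1 H1 :: "'a incidence"
    and \<kappa>2 H2 :: "'b incidence"
    and \<kappa> H :: "('a \<times> 'b) incidence"
  assumes "weak_rank rk1" and "weak_rank rk2"
    and "is_kernel rk1 \<kappa>1" and "is_kernel rk2 \<kappa>2"
    and "\<kappa> = \<kappa>1 \<otimes> \<kappa>2"
    and "H1 = chow_function \<kappa>1" and "H2 = chow_function \<kappa>2" and "H = chow_function \<kappa>"
  shows
    "H = H1 \<otimes> H2 + polyX *\<^sub>p (H * (H1 \<otimes> H2)) - polyX *\<^sub>p (H * (1 \<otimes> H2))
         - polyX *\<^sub>p (H * (H1 \<otimes> 1)) + polyX *\<^sub>p H \<and>
     H = H1 \<otimes> H2 + polyX *\<^sub>p ((H1 \<otimes> H2) * H) - polyX *\<^sub>p ((1 \<otimes> H2) * H)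
         - polyX *\<^sub>p ((H1 \<otimes> 1) * H) + polyX *\<^sub>p H"
proof -
  let ?r1 = "reduced_kernel \<kappa>1" and ?r2 = "reduced_kernel \<kappa>2" and ?r = "reduced_kernel \<kappa>"
  let ?T = "H1 \<otimes> H2"
  note H_defs = assms(6-8)
  have inv1: "?r1 * H1 = - 1" "H1 * ?r1 = - 1"
    and inv2: "?r2 * H2 = - 1" "H2 * ?r2 = - 1"
    and inv: "?r * H = - 1" "H * ?r = - 1"
    unfolding H_defs by (rule reduced_kernel_mult_chow_function)+
  have r: "?r = [:-1, 1:] *\<^sub>p (?r1 \<otimes> ?r2) + polyX *\<^sub>p (?r1 \<otimes> 1) + polyX *\<^sub>p (1 \<otimes> ?r2)
      + polyX *\<^sub>p 1"
    unfolding assms(5) by (rule reduced_kernel_tensor[OF assms(1-4)])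
  \<comment> \<open>Multiplied by \<open>H1 \<otimes> H2\<close>, each reduced kernel in a tensor factor cancels against its
    Chow function, with a sign.\<close>
  have rT: "?r * ?T = polyX *\<^sub>p 1 - 1 - polyX *\<^sub>p (1 \<otimes> H2) - polyX *\<^sub>p (H1 \<otimes> 1) + polyX *\<^sub>p ?T"
    unfolding r
    by (simp add: distrib_right left_diff_distrib scale_mult_left tensor_mult inv1 inv2 tensor_minus_left
        tensor_minus_right tensor_one scale_minus_right scale_polyX_minus_one)
  have Tr: "?T * ?r = polyX *\<^sub>p 1 - 1 - polyX *\<^sub>p (1 \<otimes> H2) - polyX *\<^sub>p (H1 \<otimes> 1) + polyX *\<^sub>p ?T"
    unfolding r
    by (simp add: distrib_left right_diff_distrib scale_mult_right tensor_mult inv1 inv2 tensor_minus_left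
        tensor_minus_right tensor_one scale_minus_right scale_polyX_minus_one)
  have "- ?T = H * (?r * ?T)"
    by (simp add: mult.assoc[symmetric] inv)
  also have "\<dots> = polyX *\<^sub>p H - H - polyX *\<^sub>p (H * (1 \<otimes> H2)) - polyX *\<^sub>p (H * (H1 \<otimes> 1))
      + polyX *\<^sub>p (H * ?T)"
    unfolding rT by (simp add: distrib_left right_diff_distrib scale_mult_right)
  finally have left: "- ?T = \<dots>" .
  have "- ?T = (?T * ?r) * H"
    by (simp add: mult.assoc inv)
  also have "\<dots> = polyX *\<^sub>p H - H - polyX *\<^sub>p ((1 \<otimes> H2) * H) - polyX *\<^sub>p ((H1 \<otimes> 1) * H)
      + polyX *\<^sub>p (?T * H)"
    unfolding Tr by (simp add: distrib_right left_diff_distrib scale_mult_left)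
  finally have right: "- ?T = \<dots>" .
  have rearrange: "h = t + d - b - c + a" if "- t = a - h - b - c + d"
    for a b c d h t :: "('a \<times> 'b) incidence"
  proof -
    have "t = - (a - h - b - c + d)" by (simp flip: that)
    then show ?thesis by simp
  qed
  from rearrange[OF left] rearrange[OF right] show ?thesis by (rule conjI)
qed

end
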